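(* Let $q=2^m$ for some integer $m>0$, let $\mathcal{F}$ be a field with $q$ elements, and let $\mathcal{S}=\mathrm{SL}(2,\mathcal{F})$. Let $w\in\mathcal{F}$ be such that $x^2-wx+1$ is an irreducible polynomial over $\mathcal{F}$, and let $$A=\begin{pmatrix}1&1\\0&1\end{pmatrix},\qquad B=\begin{pmatrix}0&1\\-1&w\end{pmatrix}$$ in $\mathcal{S}$. Then $\eta(A^{\mathcal{S}}B^{\mathcal{S}})=q-1$. Hence the lower bound $2^m-1$ for the number of conjugacy classes in the product of two noncentral conjugacy classes of $\mathrm{SL}(2,2^m)$ is optimal: for every integer $m>0$ there are noncentral matrices $A,B\in\mathrm{SL}(2,2^m)$ such that the product of their conjugacy classes is the union of exactly $2^m-1$ distinct conjugacy classes.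
   Context: $\mathrm{SL}(2,\mathcal{F})$ is the group of $2\times 2$ matrices of determinant $1$ over $\mathcal{F}$; $\mathrm{SL}(2,q)$ denotes this group when $\mathcal{F}$ has $q$ elements. For a finite group $\mathcal{G}$ and $A\in\mathcal{G}$, $A^{\mathcal{G}}=\{B^{-1}AB\mid B\in\mathcal{G}\}$ is the conjugacy class of $A$. The product of two classes is $A^{\mathcal{G}}B^{\mathcal{G}}=\{XY\mid X\in A^{\mathcal{G}},\,Y\in B^{\mathcal{G}}\}$, which is a union of conjugacy classes. For a conjugation-invariant subset $\mathcal{X}$ of $\mathcal{G}$, $\eta(\mathcal{X})$ denotes the number of distinct conjugacy classes of $\mathcal{G}$ whose union is $\mathcal{X}$. *)

theory Defs
  imports
    "HOL-Analysis.Analysis"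
    "HOL-Algebra.Coset"
    "HOL-Algebra.Algebraic_Closure_Type"
    "HOL-Library.Z2"
begin

definition SL2 :: "('a::field^2^2) monoid" where
  "SL2 = \<lparr>carrier = {M. det M = 1}, monoid.mult = (**), one = mat 1\<rparr>"

definition conj_class :: "('g, 'm) monoid_scheme \<Rightarrow> 'g \<Rightarrow> 'g set" where
  "conj_class G a = {inv\<^bsub>G\<^esub> b \<otimes>\<^bsub>G\<^esub> a \<otimes>\<^bsub>G\<^esub> b | b. b \<in> carrier G}"

definition conj_classes :: "('g, 'm) monoid_scheme \<Rightarrow> 'g set set" where
  "conj_classes G = conj_class G ` carrier G"

definition group_center :: "('g, 'm) monoid_scheme \<Rightarrow> 'g set" where
  "group_center G = {z \<in> carrier G. \<forall>x\<in>carrier G. z \<otimes>\<^bsub>G\<^esub> x = x \<otimes>\<^bsub>G\<^esub> z}"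

text \<open>
  Conjugacy classes of a group are nonempty and pairwise disjoint, so for a conjugation-invariant
  subset the family of classes below exists and is unique. The value is not meaningful for
  other subsets.
\<close>

definition num_classes :: "('g, 'm) monoid_scheme \<Rightarrow> 'g set \<Rightarrow> nat" where
  "num_classes G S = card (THE \<C>. \<C> \<subseteq> conj_classes G \<and> \<Union>\<C> = S)"

text \<open>
  For finite \<open>'n\<close>, a field with \<open>2 ^ CARD('n)\<close> elements, realised inside an algebraic closure of the field with
  two elements as the fixed points of the \<open>CARD('n)\<close>-th power of Frobenius.
\<close>

typedef 'n gf_two_pow = "{x :: bit alg_closure. x ^ (2 ^ CARD('n)) = x}"
  by (rule exI[of _ 1]) simp

setup_lifting type_definition_gf_two_pow

lemma two_eq_zero_bit_alg_closure: "(2 :: bit alg_closure) = 0"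
proof -
  have "(2 :: bit alg_closure) = to_ac (2 :: bit)"
    by (rule to_ac_numeral [symmetric])
  also have "(2 :: bit) = 0"
    by simp
  finally show ?thesis by simp
qed

lemma frobenius_add_bit_alg_closure:
  "((x :: bit alg_closure) + y) ^ (2 ^ k) = x ^ (2 ^ k) + y ^ (2 ^ k)"
proof (induction k)
  case (Suc k)
  have "(x + y) ^ (2 ^ Suc k) = ((x + y) ^ (2 ^ k))\<^sup>2"
    by (simp add: power_mult [symmetric] mult.commute)
  also have "\<dots> = (x ^ (2 ^ k) + y ^ (2 ^ k))\<^sup>2"
    by (simp add: Suc)
  also have "\<dots> = (x ^ (2 ^ k))\<^sup>2 + (y ^ (2 ^ k))\<^sup>2"
    by (simp add: power2_sum two_eq_zero_bit_alg_closure)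
  also have "\<dots> = x ^ (2 ^ Suc k) + y ^ (2 ^ Suc k)"
    by (simp add: power_mult [symmetric] mult.commute)
  finally show ?case .
qed simp

lemma uminus_bit_alg_closure: "- (x :: bit alg_closure) = x"
proof -
  have "x + x = 2 * x"
    by simp
  then have "x + x = 0"
    by (simp add: two_eq_zero_bit_alg_closure)
  then show ?thesis
    by (simp add: add_eq_0_iff)
qed

instantiation gf_two_pow :: (type) field
begin

lift_definition zero_gf_two_pow :: "'a gf_two_pow" is 0 by simp
lift_definition one_gf_two_pow :: "'a gf_two_pow" is 1 by simp
lift_definition plus_gf_two_pow :: "'a gf_two_pow \<Rightarrow> 'a gf_two_pow \<Rightarrow> 'a gf_two_pow" is "(+)"
  by (simp add: frobenius_add_bit_alg_closure)
lift_definition uminus_gf_two_pow :: "'a gf_two_pow \<Rightarrow> 'a gf_two_pow" is uminus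
  by (simp add: uminus_bit_alg_closure)
lift_definition minus_gf_two_pow :: "'a gf_two_pow \<Rightarrow> 'a gf_two_pow \<Rightarrow> 'a gf_two_pow" is "(-)"
  by (simp add: diff_conv_add_uminus uminus_bit_alg_closure frobenius_add_bit_alg_closure
      del: add_uminus_conv_diff)
lift_definition times_gf_two_pow :: "'a gf_two_pow \<Rightarrow> 'a gf_two_pow \<Rightarrow> 'a gf_two_pow" is "(*)"
  by (simp add: power_mult_distrib)
lift_definition inverse_gf_two_pow :: "'a gf_two_pow \<Rightarrow> 'a gf_two_pow" is inverse
  by (simp add: power_inverse)
lift_definition divide_gf_two_pow :: "'a gf_two_pow \<Rightarrow> 'a gf_two_pow \<Rightarrow> 'a gf_two_pow" is "(/)"
  by (simp add: power_divide)

instance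
  by standard (transfer; simp add: algebra_simps divide_inverse)+

end

end

theory Submission
  imports Defs "HOL-Number_Theory.Residues"
begin

text \<open>
  Over a finite field of characteristic two every element is a square, and this makes the conjugacy
  classes of SL(2) as simple as possible: two matrices of determinant one, neither of them the
  identity, are conjugate precisely when they have the same trace. A basis \<open>(v, - M v)\<close> turns \<open>M\<close> into
  the companion matrix of its characteristic polynomial, and rescaling \<open>v\<close> by a square root adjusts
  the determinant of the base change to one (\<open>similar_companion2\<close>, \<open>conj_class_SL2\<close>).

  The classes in the product of two classes are those of \<open>A Y\<close> with \<open>A\<close> fixed and \<open>Y\<close> varying in the
  class of \<open>B\<close> (\<open>set_mult_conj_class\<close>). For the transvection \<open>A\<close> the trace of \<open>A Y\<close> is \<open>w + c\<close>, where \<open>c\<close>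
  is the lower left entry of \<open>Y\<close>. When \<open>x\<^sup>2 - w x + 1\<close> has no root, \<open>Y\<close> cannot be triangular, so \<open>c\<close> runs
  through all nonzero elements and \<open>A Y\<close> is never the identity. The product is therefore the union of
  the classes of nonidentity matrices of trace \<open>t\<close> for \<open>t \<noteq> w\<close>, and these are \<open>q - 1\<close> distinct classes
  (\<open>transvection2_companion2_product\<close>).

  A suitable \<open>w\<close> exists because \<open>x \<mapsto> x + x\<^sup>-\<^sup>1\<close> has only \<open>q - 1\<close> arguments
  (\<open>exists_rootless_quadratic\<close>). Fields of every order \<open>2\<^sup>n\<close> exist because \<open>X\<^sup>k - X\<close>, \<open>k = 2\<^sup>n\<close>, is
  separable and splits in the algebraic closure (\<open>card_gf_two_pow\<close>).
\<close>

\<comment> \<open>Matrix entries and power series coefficients share this symbol; only matrix entries occur below.\<close>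
no_notation fps_nth (infixl \<open>$\<close> 75)

section \<open>Conjugacy classes of a group\<close>

lemma (in group) mult_inv_mult: "g \<in> carrier G \<Longrightarrow> x \<in> carrier G \<Longrightarrow> g \<otimes> (inv g \<otimes> x) = x"
  by (simp flip: m_assoc)

lemma conj_class_memI:
  assumes "group G" "g \<in> carrier G" "a \<in> carrier G" "b \<in> carrier G"
    and "a \<otimes>\<^bsub>G\<^esub> g = g \<otimes>\<^bsub>G\<^esub> b"
  shows "b \<in> conj_class G a"
proof -
  interpret group G by fact
  have "inv\<^bsub>G\<^esub> g \<otimes>\<^bsub>G\<^esub> a \<otimes>\<^bsub>G\<^esub> g = inv\<^bsub>G\<^esub> g \<otimes>\<^bsub>G\<^esub> (g \<otimes>\<^bsub>G\<^esub> b)"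
    using assms by (simp add: m_assoc)
  also have "\<dots> = b"
    using assms by (simp flip: m_assoc)
  finally show ?thesis
    using assms(2) by (auto simp: conj_class_def)
qed

lemma conj_class_memD:
  assumes "group G" "a \<in> carrier G" "b \<in> conj_class G a"
  obtains g where "g \<in> carrier G" "b \<in> carrier G" "a \<otimes>\<^bsub>G\<^esub> g = g \<otimes>\<^bsub>G\<^esub> b"
proof -
  interpret group G by fact
  obtain g where g: "g \<in> carrier G" "b = inv\<^bsub>G\<^esub> g \<otimes>\<^bsub>G\<^esub> a \<otimes>\<^bsub>G\<^esub> g"
    using assms(3) by (auto simp: conj_class_def)
  have "a \<otimes>\<^bsub>G\<^esub> g = g \<otimes>\<^bsub>G\<^esub> b"
    using g assms(2) by (simp add: m_assoc mult_inv_mult)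
  then show ?thesis
    using g assms(2) by (intro that[of g]) auto
qed

lemma conj_class_self: "group G \<Longrightarrow> a \<in> carrier G \<Longrightarrow> a \<in> conj_class G a"
  by (rule conj_class_memI[where g = "\<one>\<^bsub>G\<^esub>"]) (auto simp: group.is_monoid monoid.l_one monoid.r_one)

lemma conj_class_subset:
  assumes "group G" "a \<in> carrier G" "b \<in> conj_class G a"
  shows "conj_class G b \<subseteq> conj_class G a"
proof
  interpret group G by fact
  fix c
  assume c: "c \<in> conj_class G b"
  obtain g where g: "g \<in> carrier G" "b \<in> carrier G" "a \<otimes>\<^bsub>G\<^esub> g = g \<otimes>\<^bsub>G\<^esub> b"
    using conj_class_memD[OF assms] .
  obtain h where h: "h \<in> carrier G" "c \<in> carrier G" "b \<otimes>\<^bsub>G\<^esub> h = h \<otimes>\<^bsub>G\<^esub> c"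
    using conj_class_memD[OF assms(1) g(2) c] .
  have "a \<otimes>\<^bsub>G\<^esub> (g \<otimes>\<^bsub>G\<^esub> h) = (g \<otimes>\<^bsub>G\<^esub> b) \<otimes>\<^bsub>G\<^esub> h"
    using g h assms(2) by (simp flip: m_assoc)
  also have "\<dots> = (g \<otimes>\<^bsub>G\<^esub> h) \<otimes>\<^bsub>G\<^esub> c"
    using g h by (simp add: m_assoc)
  finally show "c \<in> conj_class G a"
    using g h assms by (intro conj_class_memI[where g = "g \<otimes>\<^bsub>G\<^esub> h"]) auto
qed

lemma conj_class_sym:
  assumes "group G" "a \<in> carrier G" "b \<in> conj_class G a"
  shows "a \<in> conj_class G b"
proof -
  interpret group G by fact
  obtain g where g: "g \<in> carrier G" "b \<in> carrier G" "a \<otimes>\<^bsub>G\<^esub> g = g \<otimes>\<^bsub>G\<^esub> b"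
    using conj_class_memD[OF assms] .
  have "inv\<^bsub>G\<^esub> g \<otimes>\<^bsub>G\<^esub> (a \<otimes>\<^bsub>G\<^esub> g) \<otimes>\<^bsub>G\<^esub> inv\<^bsub>G\<^esub> g = inv\<^bsub>G\<^esub> g \<otimes>\<^bsub>G\<^esub> (g \<otimes>\<^bsub>G\<^esub> b) \<otimes>\<^bsub>G\<^esub> inv\<^bsub>G\<^esub> g"
    by (simp only: g(3))
  then have "b \<otimes>\<^bsub>G\<^esub> inv\<^bsub>G\<^esub> g = inv\<^bsub>G\<^esub> g \<otimes>\<^bsub>G\<^esub> a"
    using g(1,2) assms(2) by (simp add: m_assoc inv_solve_left inv_solve_right)
  then show ?thesis
    using g assms by (intro conj_class_memI[where g = "inv\<^bsub>G\<^esub> g"]) auto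
qed

lemma conj_class_eq:
  assumes "group G" "a \<in> carrier G" "b \<in> conj_class G a"
  shows "conj_class G b = conj_class G a"
  using assms conj_class_subset conj_class_sym conj_class_memD by (metis subset_antisym)

lemma conj_classes_family_subset:
  assumes G: "group G" and C: "\<C> \<subseteq> conj_classes G" and D: "\<D> \<subseteq> conj_classes G"
    and eq: "\<Union>\<C> = \<Union>\<D>"
  shows "\<C> \<subseteq> \<D>"
proof
  fix K
  assume K: "K \<in> \<C>"
  then obtain a where a: "a \<in> carrier G" "K = conj_class G a"
    using C by (auto simp: conj_classes_def)
  have "a \<in> \<Union>\<D>"
    using K a conj_class_self[OF G] eq by blast
  then obtain L where L: "L \<in> \<D>" "a \<in> L"
    by blast
  then obtain b where "b \<in> carrier G" "L = conj_class G b"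
    using D by (auto simp: conj_classes_def)
  with L a show "K \<in> \<D>"
    using conj_class_eq[OF G] by metis
qed

text \<open>
  Distinct classes are disjoint and no class is empty, so a union of classes determines the
  family; the definite description in \<^const>\<open>num_classes\<close> then denotes that family.
\<close>

lemma num_classes_Union:
  assumes "group G" "\<C> \<subseteq> conj_classes G"
  shows "num_classes G (\<Union>\<C>) = card \<C>"
proof -
  have "(THE \<D>. \<D> \<subseteq> conj_classes G \<and> \<Union>\<D> = \<Union>\<C>) = \<C>"
    using assms conj_classes_family_subset[OF assms(1)]
    by (intro the_equality) (simp, metis subset_antisym)
  then show ?thesis
    by (simp add: num_classes_def)
qed

text \<open>
  Conjugating \<open>g\<^sup>-\<^sup>1 a g \<cdot> y\<close> by \<open>g\<^sup>-\<^sup>1\<close> gives \<open>a \<cdot> g y g\<^sup>-\<^sup>1\<close>. One factor of a product of classes can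
  thus be held fixed when the classes that occur in it are determined.
\<close>

lemma set_mult_conj_class:
  assumes "group G" "a \<in> carrier G" "b \<in> carrier G"
  shows "conj_class G a <#>\<^bsub>G\<^esub> conj_class G b = (\<Union>y\<in>conj_class G b. conj_class G (a \<otimes>\<^bsub>G\<^esub> y))"
proof (intro equalityI subsetI)
  interpret group G by fact
  fix z
  assume "z \<in> conj_class G a <#>\<^bsub>G\<^esub> conj_class G b"
  then obtain x y where x: "x \<in> conj_class G a" and y: "y \<in> conj_class G b"
    and z: "z = x \<otimes>\<^bsub>G\<^esub> y"
    by (auto simp: set_mult_def)
  obtain g where g: "g \<in> carrier G" "x \<in> carrier G" "a \<otimes>\<^bsub>G\<^esub> g = g \<otimes>\<^bsub>G\<^esub> x"
    using conj_class_memD[OF assms(1,2) x] .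
  have yc: "y \<in> carrier G"
    using conj_class_memD[OF assms(1,3) y] by metis
  define y' where "y' = g \<otimes>\<^bsub>G\<^esub> y \<otimes>\<^bsub>G\<^esub> inv\<^bsub>G\<^esub> g"
  have y'c: "y' \<in> carrier G" and y'g: "y' \<otimes>\<^bsub>G\<^esub> g = g \<otimes>\<^bsub>G\<^esub> y"
    using g yc by (auto simp: y'_def m_assoc)
  have "y \<in> conj_class G y'"
    using conj_class_memI[OF assms(1) g(1) y'c yc y'g] .
  then have "y' \<in> conj_class G b"
    using conj_class_sym[OF assms(1) y'c] conj_class_subset[OF assms(1,3) y] by blast
  moreover have "z \<in> conj_class G (a \<otimes>\<^bsub>G\<^esub> y')"
  proof (rule conj_class_memI[OF assms(1) g(1)])
    have "a \<otimes>\<^bsub>G\<^esub> y' \<otimes>\<^bsub>G\<^esub> g = (a \<otimes>\<^bsub>G\<^esub> g) \<otimes>\<^bsub>G\<^esub> y"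
      using g(1) yc y'c assms(2) by (simp add: m_assoc y'g)
    also have "\<dots> = g \<otimes>\<^bsub>G\<^esub> z"
      using g yc z by (simp add: m_assoc)
    finally show "a \<otimes>\<^bsub>G\<^esub> y' \<otimes>\<^bsub>G\<^esub> g = g \<otimes>\<^bsub>G\<^esub> z" .
  qed (use g yc y'c z assms in auto)
  ultimately show "z \<in> (\<Union>y\<in>conj_class G b. conj_class G (a \<otimes>\<^bsub>G\<^esub> y))"
    by blast
next
  interpret group G by fact
  fix z
  assume "z \<in> (\<Union>y\<in>conj_class G b. conj_class G (a \<otimes>\<^bsub>G\<^esub> y))"
  then obtain y where y: "y \<in> conj_class G b" and z: "z \<in> conj_class G (a \<otimes>\<^bsub>G\<^esub> y)"
    by blast
  have yc: "y \<in> carrier G"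
    using conj_class_memD[OF assms(1,3) y] by metis
  obtain g where g: "g \<in> carrier G" "z = inv\<^bsub>G\<^esub> g \<otimes>\<^bsub>G\<^esub> (a \<otimes>\<^bsub>G\<^esub> y) \<otimes>\<^bsub>G\<^esub> g"
    using z by (auto simp: conj_class_def)
  define x' where "x' = inv\<^bsub>G\<^esub> g \<otimes>\<^bsub>G\<^esub> a \<otimes>\<^bsub>G\<^esub> g"
  define y' where "y' = inv\<^bsub>G\<^esub> g \<otimes>\<^bsub>G\<^esub> y \<otimes>\<^bsub>G\<^esub> g"
  have "x' \<in> conj_class G a" "y' \<in> conj_class G y"
    using g by (auto simp: x'_def y'_def conj_class_def)
  moreover have "z = x' \<otimes>\<^bsub>G\<^esub> y'"
    using g assms(2) yc by (simp add: x'_def y'_def m_assoc mult_inv_mult)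
  ultimately show "z \<in> conj_class G a <#>\<^bsub>G\<^esub> conj_class G b"
    using conj_class_subset[OF assms(1,3) y] by (auto simp: set_mult_def)
qed

section \<open>The classes of SL(2) over a perfect field of characteristic two\<close>

lemma SL2_simps [simp]:
  "M \<in> carrier SL2 \<longleftrightarrow> det M = 1" "M \<otimes>\<^bsub>SL2\<^esub> N = M ** N" "\<one>\<^bsub>SL2\<^esub> = mat 1"
  by (auto simp: SL2_def)

lemma group_SL2: "group (SL2 :: ('a::field^2^2) monoid)"
proof (rule groupI)
  fix M :: "'a^2^2"
  assume "M \<in> carrier SL2"
  then have M: "det M = 1"
    by simp
  then have "invertible M"
    by (simp add: invertible_det_nz)
  then obtain N where N: "N ** M = mat 1"
    unfolding invertible_def by blast
  have "det N * det M = 1"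
    unfolding det_mul[symmetric] N by (rule det_I)
  then have "N \<in> carrier SL2"
    using M by simp
  with N show "\<exists>N\<in>carrier SL2. N \<otimes>\<^bsub>SL2\<^esub> M = \<one>\<^bsub>SL2\<^esub>"
    by (intro bexI[of _ N]) (simp_all only: SL2_simps)
qed (simp_all only: SL2_simps det_mul det_I mult_1 matrix_mul_lid matrix_mul_assoc)

lemma matrix2_eq_iff:
  "(M :: 'a^2^2) = N \<longleftrightarrow>
     M$1$1 = N$1$1 \<and> M$1$2 = N$1$2 \<and> M$2$1 = N$2$1 \<and> M$2$2 = N$2$2"
  by (auto simp: vec_eq_iff forall_2)

lemma matrix2_mult_nth:
  "((M :: 'a::semiring_1^2^2) ** N)$i$j = M$i$1 * N$1$j + M$i$2 * N$2$j"
  by (simp add: matrix_matrix_mult_def sum_2)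

lemma trace_2: "trace (M :: 'a::semiring_1^2^2) = M$1$1 + M$2$2"
  by (simp add: trace_def sum_2)

definition companion2 :: "'a::field \<Rightarrow> 'a^2^2" where
  "companion2 t = vector [vector [0, 1], vector [- 1, t]]"

definition nonid_trace :: "'a::field \<Rightarrow> ('a^2^2) set" where
  "nonid_trace t = {M. det M = 1 \<and> M \<noteq> mat 1 \<and> trace M = t}"

lemma companion2_nth [simp]:
  "companion2 t $ 1 $ 1 = 0" "companion2 t $ 1 $ 2 = 1"
  "companion2 t $ 2 $ 1 = - 1" "companion2 t $ 2 $ 2 = t"
  by (simp_all add: companion2_def)

lemma companion2_mem: "companion2 t \<in> nonid_trace t"
  by (simp add: nonid_trace_def det_2 trace_2 matrix2_eq_iff mat_def)

lemma char2_minus: "(2::'a::field) = 0 \<Longrightarrow> - x = (x::'a)"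
  by (metis add_eq_0_iff mult_2 mult_zero_left)

lemma char2_square_inj:
  assumes "(2::'a::field) = 0" "(x::'a)\<^sup>2 = y\<^sup>2"
  shows "x = y"
  using assms char2_minus[OF assms(1), of y] by (auto simp: power2_eq_iff)

text \<open>
  If \<open>(v, - M v)\<close> is a basis, then Cayley-Hamilton says that \<open>M\<close> acts on it by the companion matrix.
  The determinant of this basis is a quadratic form in \<open>v\<close>, which does not vanish identically
  because \<open>M\<close> is not scalar: characteristic two makes the identity the only scalar matrix of
  determinant one. Since every field element is a square, scaling \<open>v\<close> makes the determinant
  equal to one, so that the conjugating matrix lies in SL(2) and not merely in GL(2).
\<close>

lemma similar_companion2:
  fixes M :: "'a::field^2^2"
  assumes two: "(2::'a) = 0" and sqrt: "\<And>x::'a. \<exists>y. y\<^sup>2 = x"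
    and M: "M \<in> nonid_trace t"
  obtains g :: "'a^2^2" where "det g = 1" "M ** g = g ** companion2 t"
proof -
  define a b c d where abcd: "a = M$1$1" "b = M$1$2" "c = M$2$1" "d = M$2$2"
  have det: "a * d - b * c = 1" and tr: "t = a + d"
    using M by (auto simp: nonid_trace_def det_2 trace_2 abcd)
  have "M \<noteq> mat 1"
    using M by (simp add: nonid_trace_def)
  define Q where "Q x y = - c * x\<^sup>2 + (a - d) * x * y + b * y\<^sup>2" for x y
  \<comment> \<open>\<open>Q x y\<close> is the determinant of the matrix with columns \<open>v\<close> and \<open>- M v\<close> for \<open>v = (x, y)\<close>.\<close>
  have "\<exists>x y. Q x y \<noteq> 0"
  proof (rule ccontr)
    assume "\<not> ?thesis"
    then have Q0: "Q x y = 0" for x y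
      by blast
    have "c = 0" "b = 0" "a = d"
      using Q0[of 1 0] Q0[of 0 1] Q0[of 1 1] by (auto simp: Q_def)
    with det have "d\<^sup>2 = 1\<^sup>2"
      by (simp add: power2_eq_square)
    then have "d = 1"
      by (rule char2_square_inj[OF two])
    with \<open>c = 0\<close> \<open>b = 0\<close> \<open>a = d\<close> have "M = mat 1"
      by (simp add: matrix2_eq_iff mat_def abcd)
    with \<open>M \<noteq> mat 1\<close> show False ..
  qed
  then obtain x y where xy: "Q x y \<noteq> 0"
    by blast
  obtain s where s: "s\<^sup>2 = inverse (Q x y)"
    using sqrt by blast
  have Q1: "Q (s * x) (s * y) = 1"
  proof -
    have "Q (s * x) (s * y) = s\<^sup>2 * Q x y"
      by (simp add: Q_def algebra_simps power2_eq_square)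
    with s xy show ?thesis
      by simp
  qed
  define v1 v2 where v: "v1 = s * x" "v2 = s * y"
  define g :: "'a^2^2" where
    "g = vector [vector [v1, - (a * v1 + b * v2)], vector [v2, - (c * v1 + d * v2)]]"
  have "det g = Q v1 v2"
    by (simp add: g_def det_2 Q_def algebra_simps power2_eq_square)
  then have "det g = 1"
    using Q1 v by simp
  moreover have "M ** g = g ** companion2 t"
  proof -
    have "a * (a * v1 + b * v2) + b * (c * v1 + d * v2) =
        t * (a * v1 + b * v2) - (a * d - b * c) * v1"
      by (simp add: tr algebra_simps)
    moreover have "c * (a * v1 + b * v2) + d * (c * v1 + d * v2) =
        t * (c * v1 + d * v2) - (a * d - b * c) * v2"
      by (simp add: tr algebra_simps)
    ultimately show ?thesis
      by (simp add: matrix2_eq_iff matrix2_mult_nth g_def det flip: abcd) (simp add: algebra_simps)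
  qed
  ultimately show thesis
    by (rule that)
qed

text \<open>
  All nonidentity matrices of trace \<open>t\<close> are conjugate to the same companion matrix, and conjugation
  preserves the trace and the property of not being the identity.
\<close>

lemma conj_class_SL2:
  fixes M :: "'a::field^2^2"
  assumes two: "(2::'a) = 0" and sqrt: "\<And>x::'a. \<exists>y. y\<^sup>2 = x"
    and M: "M \<in> nonid_trace t"
  shows "conj_class SL2 M = nonid_trace t"
proof (intro equalityI subsetI)
  note G = group_SL2[where 'a = 'a]
  interpret group "SL2 :: ('a^2^2) monoid" by (rule G)
  have det1: "det N = 1" if "N \<in> nonid_trace s" for N :: "'a^2^2" and s
    using that by (simp add: nonid_trace_def)
  have class_eq: "conj_class SL2 N = conj_class SL2 (companion2 t)" if N: "N \<in> nonid_trace t" for N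
  proof -
    obtain g :: "'a^2^2" where "det g = 1" "N ** g = g ** companion2 t"
      using similar_companion2[OF two sqrt N] .
    then have "companion2 t \<in> conj_class SL2 N"
      using det1[OF N] det1[OF companion2_mem] by (intro conj_class_memI[OF G, of g]) auto
    then show ?thesis
      using conj_class_eq[OF G] det1[OF N] by simp
  qed
  {
    fix N
    assume "N \<in> nonid_trace t"
    then show "N \<in> conj_class SL2 M"
      using conj_class_self[OF G, of N] class_eq[of N] class_eq[OF M] det1[of N] by simp
  next
    fix N
    assume N: "N \<in> conj_class SL2 M"
    have Mc: "M \<in> carrier SL2"
      using det1[OF M] by simp
    obtain g where g: "det g = 1" "det N = 1" "M ** g = g ** N"
      using conj_class_memD[OF G Mc N] by auto
    have "invertible g"
      using g by (simp add: invertible_det_nz)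
    then obtain h where h: "g ** h = mat 1" "h ** g = mat 1"
      unfolding invertible_def by blast
    have M_eq: "M = g ** N ** h"
      using g(3) h by (metis matrix_mul_assoc matrix_mul_rid)
    have "trace M = trace (N ** h ** g)"
      unfolding M_eq by (metis matrix_mul_assoc trace_mul_sym)
    then have "trace N = t"
      using M h(2) by (simp add: nonid_trace_def flip: matrix_mul_assoc)
    moreover have "N \<noteq> mat 1"
      using M M_eq h by (auto simp: nonid_trace_def)
    ultimately show "N \<in> nonid_trace t"
      using g(2) by (simp add: nonid_trace_def)
  }
qed

lemma nonid_trace_in_conj_classes:
  assumes "(2::'a::field) = 0" "\<And>x::'a. \<exists>y. y\<^sup>2 = x"
  shows "nonid_trace (t::'a) \<in> conj_classes SL2"
  using conj_class_SL2[OF assms companion2_mem] companion2_mem[of t]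
  by (auto simp: conj_classes_def nonid_trace_def intro!: rev_image_eqI[of "companion2 t"])

lemma inj_nonid_trace: "inj nonid_trace"
proof (rule injI)
  fix s t :: 'a
  assume "nonid_trace s = nonid_trace t"
  then have "companion2 s \<in> nonid_trace t"
    using companion2_mem by metis
  then show "s = t"
    by (simp add: nonid_trace_def trace_2)
qed

section \<open>The product of the two classes\<close>

definition transvection2 :: "'a::field^2^2" where
  "transvection2 = vector [vector [1, 1], vector [0, 1]]"

lemma transvection2_nth [simp]:
  "transvection2 $ 1 $ 1 = 1" "transvection2 $ 1 $ 2 = 1"
  "transvection2 $ 2 $ 1 = 0" "transvection2 $ 2 $ 2 = 1"
  by (simp_all add: transvection2_def)

lemma det_transvection2: "det transvection2 = 1"
  by (simp add: det_2)

text \<open>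
  Left multiplication by the transvection adds the lower left entry of \<open>Y\<close> to its trace. This entry
  is nonzero, since the diagonal entries of a triangular matrix of determinant one and trace \<open>w\<close> are
  roots of \<open>x\<^sup>2 - w x + 1\<close>, and it is otherwise arbitrary. Being nonzero, it is also the lower left
  entry of a product \<open>A Y\<close> that cannot be the identity, so the trace of \<open>A Y\<close> determines its class.
\<close>

lemma transvection2_companion2_product:
  fixes w :: "'a::field"
  assumes two: "(2::'a) = 0" and sqrt: "\<And>x::'a. \<exists>y. y\<^sup>2 = x"
    and no_root: "\<And>x. x\<^sup>2 - w * x + 1 \<noteq> 0"
  shows "conj_class SL2 transvection2 <#>\<^bsub>SL2\<^esub> conj_class SL2 (companion2 w) =
    \<Union>(nonid_trace ` (- {w}))"
proof -
  have class_w: "conj_class SL2 (companion2 w) = nonid_trace w"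
    by (rule conj_class_SL2[OF two sqrt companion2_mem])
  have Y21: "Y$2$1 \<noteq> 0" if Y: "Y \<in> nonid_trace w" for Y
  proof
    assume "Y$2$1 = 0"
    then have "Y$1$1 * Y$2$2 = 1" "Y$1$1 + Y$2$2 = w"
      using Y by (auto simp: nonid_trace_def det_2 trace_2)
    then have "(Y$1$1)\<^sup>2 - w * Y$1$1 + 1 = 0"
      by (auto simp: power2_eq_square algebra_simps)
    with no_root show False
      by blast
  qed
  have class_prod: "conj_class SL2 (transvection2 ** Y) = nonid_trace (w + Y$2$1)"
    if Y: "Y \<in> nonid_trace w" for Y
  proof (rule conj_class_SL2[OF two sqrt])
    have "(transvection2 ** Y)$2$1 \<noteq> 0"
      using Y21[OF Y] by (simp add: matrix2_mult_nth)
    then have "transvection2 ** Y \<noteq> mat 1"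
      by (auto simp: mat_def)
    moreover have "trace (transvection2 ** Y) = w + Y$2$1"
      using Y by (simp add: nonid_trace_def trace_2 matrix2_mult_nth algebra_simps)
    ultimately show "transvection2 ** Y \<in> nonid_trace (w + Y$2$1)"
      using Y by (simp add: nonid_trace_def det_mul det_transvection2)
  qed
  have shifts: "(\<lambda>Y. w + Y$2$1) ` nonid_trace w = - {w}"
  proof (intro equalityI subsetI)
    fix t
    assume t: "t \<in> - {w}"
    \<comment> \<open>The lower left entry has to be \<open>t - w\<close>; diagonal \<open>0, w\<close> gives trace \<open>w\<close>, and the last entry is
      then forced by the determinant.\<close>
    define Y :: "'a^2^2" where
      "Y = vector [vector [0, - inverse (t - w)], vector [t - w, w]]"
    have "Y \<in> nonid_trace w"
      using t by (simp add: nonid_trace_def Y_def det_2 trace_2 matrix2_eq_iff mat_def)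
    moreover have "t = w + Y$2$1"
      by (simp add: Y_def)
    ultimately show "t \<in> (\<lambda>Y. w + Y$2$1) ` nonid_trace w"
      by blast
  qed (use Y21 in auto)
  have "conj_class SL2 transvection2 <#>\<^bsub>SL2\<^esub> conj_class SL2 (companion2 w) =
      (\<Union>Y\<in>nonid_trace w. conj_class SL2 (transvection2 ** Y))"
    using set_mult_conj_class[OF group_SL2, of transvection2 "companion2 w"]
      companion2_mem[of w] det_transvection2
    by (simp add: class_w nonid_trace_def)
  also have "\<dots> = (\<Union>Y\<in>nonid_trace w. nonid_trace (w + Y$2$1))"
    by (intro SUP_cong refl class_prod)
  also have "\<dots> = \<Union>(nonid_trace ` ((\<lambda>Y. w + Y$2$1) ` nonid_trace w))"
    by (simp add: image_image)
  finally show ?thesis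
    by (simp only: shifts)
qed

lemma not_in_group_centerI:
  "x \<in> carrier G \<Longrightarrow> z \<otimes>\<^bsub>G\<^esub> x \<noteq> x \<otimes>\<^bsub>G\<^esub> z \<Longrightarrow> z \<notin> group_center G"
  by (auto simp: group_center_def)

lemma transvection2_companion2_noncentral:
  fixes w :: "'a::field"
  shows "transvection2 \<notin> group_center (SL2 :: ('a^2^2) monoid)"
    and "companion2 w \<notin> group_center SL2"
proof -
  have "(transvection2 ** companion2 w)$1$1 \<noteq> (companion2 w ** transvection2)$1$1"
    by (simp add: matrix2_mult_nth)
  then have ne: "transvection2 \<otimes>\<^bsub>SL2\<^esub> companion2 w \<noteq> companion2 w \<otimes>\<^bsub>SL2\<^esub> transvection2"
    unfolding SL2_simps by metis
  have mem: "companion2 w \<in> carrier SL2" "transvection2 \<in> carrier (SL2 :: ('a^2^2) monoid)"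
    using companion2_mem[of w] det_transvection2 by (simp_all add: nonid_trace_def)
  show "transvection2 \<notin> group_center (SL2 :: ('a^2^2) monoid)"
    using mem(1) ne by (rule not_in_group_centerI)
  show "companion2 w \<notin> group_center SL2"
    using mem(2) ne[symmetric] by (rule not_in_group_centerI)
qed

section \<open>Fields with a power of two elements\<close>

lemma two_eq_zero_if_card_eq_two_power:
  assumes "CARD('a::field) = 2 ^ m"
  shows "(2::'a) = 0"
proof -
  have "finite (UNIV :: 'a set)"
    using assms by (simp add: card_ge_0_finite)
  then have "Factorial_Ring.prime CHAR('a)"
    using finite_imp_CHAR_pos prime_CHAR_semidom by blast
  moreover have "CHAR('a) dvd 2 ^ m"
    using CHAR_dvd_CARD[where 'a = 'a] assms by simp
  ultimately have "CHAR('a) = 2"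
    using prime_dvd_power primes_dvd_imp_eq two_is_prime_nat by blast
  then show ?thesis
    using of_nat_CHAR[where 'a = 'a] by simp
qed

lemma char2_finite_square_surj:
  assumes "finite (UNIV :: 'a::field set)" "(2::'a) = 0"
  shows "\<exists>y::'a. y\<^sup>2 = x"
proof -
  have "inj (\<lambda>y::'a. y\<^sup>2)"
    using char2_square_inj[OF assms(2)] by (auto intro: injI)
  then have "surj (\<lambda>y::'a. y\<^sup>2)"
    using assms(1) by (simp add: finite_UNIV_inj_surj)
  then show ?thesis
    by (metis surjD)
qed

text \<open>
  A root \<open>x\<close> is nonzero and forces \<open>w = x + x\<^sup>-\<^sup>1\<close>. Only \<open>q - 1\<close> values of \<open>x\<close> are available, so this
  expression misses some of the \<open>q\<close> values of \<open>w\<close>.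
\<close>

lemma exists_rootless_quadratic:
  assumes "finite (UNIV :: 'a::field set)"
  obtains w :: "'a::field" where "\<And>x. x\<^sup>2 - w * x + 1 \<noteq> 0"
proof -
  have "card ((\<lambda>x::'a. x + inverse x) ` (UNIV - {0})) \<le> card (UNIV - {0::'a})"
    using assms by (intro card_image_le) simp
  also have "\<dots> < CARD('a)"
    using assms by (intro psubset_card_mono) auto
  finally have "(\<lambda>x::'a. x + inverse x) ` (UNIV - {0}) \<noteq> UNIV"
    by auto
  then obtain w :: 'a where w: "w \<notin> (\<lambda>x. x + inverse x) ` (UNIV - {0})"
    by blast
  have "x\<^sup>2 - w * x + 1 \<noteq> 0" for x
  proof
    assume eq: "x\<^sup>2 - w * x + 1 = 0"
    then have "x \<noteq> 0"
      by auto
    moreover from this eq have "w = x + inverse x"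
      by (simp add: field_simps power2_eq_square)
    ultimately show False
      using w by blast
  qed
  then show thesis
    by (rule that)
qed

lemma irreducible_quadratic_no_root:
  fixes w :: "'a::field"
  assumes "Factorial_Ring.irreducible [:1, - w, 1:]"
  shows "x\<^sup>2 - w * x + 1 \<noteq> 0"
proof
  assume "x\<^sup>2 - w * x + 1 = 0"
  then have "poly [:1, - w, 1:] x = 0"
    by (simp add: power2_eq_square algebra_simps)
  then obtain q where q: "[:1, - w, 1:] = [:- x, 1:] * q"
    unfolding poly_eq_0_iff_dvd by (rule dvdE)
  then have "q \<noteq> 0"
    by auto
  then have "Polynomial.degree [:1, - w, 1:] = 1 + Polynomial.degree q"
    unfolding q by (subst degree_mult_eq) auto
  then have "Polynomial.degree q = 1"
    by simp
  then have "\<not> q dvd 1" "\<not> [:- x, 1:] dvd 1"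
    by (auto simp: is_unit_iff_degree[OF \<open>q \<noteq> 0\<close>] is_unit_iff_degree)
  with assms q show False
    using Factorial_Ring.irreducibleD by blast
qed

text \<open>
  Splitting off a root \<open>x\<close> of a separable polynomial, \<open>p = (X - x) q\<close>, leaves a separable \<open>q\<close> that does
  not have \<open>x\<close> as a root, because \<open>p' = q + (X - x) q'\<close>.
\<close>

lemma card_roots_separable:
  fixes p :: "'a::alg_closed_field poly"
  assumes "\<And>x. poly p x = 0 \<Longrightarrow> poly (pderiv p) x \<noteq> 0"
  shows "card {x. poly p x = 0} = Polynomial.degree p"
  using assms
proof (induction "Polynomial.degree p" arbitrary: p)
  case 0
  then obtain c where p: "p = [:c:]"
    by (metis degree_eq_zeroE)
  then have "c \<noteq> 0"
    using "0.prems"[of 0] by auto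
  with p show ?case
    by simp
next
  case (Suc n)
  obtain x where x: "poly p x = 0"
    using alg_closed_imp_poly_has_root[of p] Suc.hyps(2) by auto
  then obtain q where q: "p = [:- x, 1:] * q"
    by (auto simp: poly_eq_0_iff_dvd dvd_def)
  have "q \<noteq> 0"
    using q Suc.hyps(2) by auto
  then have deg: "Polynomial.degree p = Suc (Polynomial.degree q)"
    unfolding q by (subst degree_mult_eq) auto
  have deriv: "poly (pderiv p) y = poly q y + (y - x) * poly (pderiv q) y" for y
    unfolding q pderiv_mult by (simp add: pderiv_pCons algebra_simps)
  have "poly q x \<noteq> 0"
    using Suc.prems[OF x] deriv[of x] by simp
  moreover have "card {y. poly q y = 0} = Polynomial.degree q"
  proof (rule Suc.hyps(1))
    fix y
    assume "poly q y = 0"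
    then have "poly p y = 0"
      by (simp add: q)
    then show "poly (pderiv q) y \<noteq> 0"
      using Suc.prems[of y] deriv[of y] \<open>poly q y = 0\<close> by auto
  qed (use Suc.hyps(2) deg in simp)
  moreover have "{y. poly p y = 0} = insert x {y. poly q y = 0}"
    by (auto simp: q)
  ultimately show ?case
    using poly_roots_finite[OF \<open>q \<noteq> 0\<close>] deg by simp
qed

text \<open>
  The elements are the roots of \<open>X\<^sup>k - X\<close> with \<open>k = 2\<^sup>n\<close>, whose derivative is the constant \<open>- 1\<close> in
  characteristic two.
\<close>

lemma card_gf_two_pow: "CARD('n::finite gf_two_pow) = 2 ^ CARD('n)"
proof -
  define k :: nat where "k = 2 ^ CARD('n)"
  have k: "k > 1" "even k"
    unfolding k_def by (intro one_less_power) simp_all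
  define p :: "bit alg_closure poly" where "p = Polynomial.monom 1 k - Polynomial.monom 1 1"
  have "of_nat k = (0 :: bit alg_closure)"
    using k(2) by (auto elim!: evenE simp: two_eq_zero_bit_alg_closure)
  then have "pderiv p = - 1"
    by (simp add: p_def pderiv_diff pderiv_monom)
  then have "card {x. poly p x = 0} = Polynomial.degree p"
    by (intro card_roots_separable) simp
  also have "Polynomial.degree p = k"
    using k(1) unfolding p_def diff_conv_add_uminus
    by (subst degree_add_eq_left) (simp_all add: degree_monom_eq)
  finally have "card {x :: bit alg_closure. x ^ k = x} = k"
    by (simp add: p_def poly_monom)
  then show ?thesis
    using type_definition.card[OF type_definition_gf_two_pow[where 'n = 'n]]
    by (simp add: k_def)
qed

section \<open>The number of classes in the product\<close>

lemma card_nonid_trace_family: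
  assumes "CARD('a::field) = 2 ^ m"
  shows "card (nonid_trace ` (- {w::'a})) = 2 ^ m - 1"
  using assms card_image[OF inj_on_subset[OF inj_nonid_trace subset_UNIV], of "- {w}"]
  by (simp add: card_Diff_singleton Compl_eq_Diff_UNIV)

theorem proposition2p13:
  shows
    "(\<forall>(m::nat) (w::'a::field).
        m > 0 \<longrightarrow> CARD('a) = 2 ^ m \<longrightarrow> Factorial_Ring.irreducible [:1, - w, 1:] \<longrightarrow>
        (let A = vector [vector [1, 1], vector [0, 1]] :: 'a^2^2;
             B = vector [vector [0, 1], vector [- 1, w]] :: 'a^2^2
         in num_classes SL2 (conj_class SL2 A <#>\<^bsub>SL2\<^esub> conj_class SL2 B) = 2 ^ m - 1))
     \<and> (\<forall>m::nat.
        m > 0 \<longrightarrow> CARD('a) = 2 ^ m \<longrightarrow>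
        (\<exists>A\<in>carrier (SL2 :: ('a^2^2) monoid). \<exists>B\<in>carrier (SL2 :: ('a^2^2) monoid).
           A \<notin> group_center SL2 \<and> B \<notin> group_center SL2 \<and>
           (\<exists>\<C>. \<C> \<subseteq> conj_classes SL2 \<and> card \<C> = 2 ^ m - 1 \<and>
                conj_class SL2 A <#>\<^bsub>SL2\<^esub> conj_class SL2 B = \<Union>\<C>)))
     \<and> CARD('n::finite gf_two_pow) = 2 ^ CARD('n)"
proof (intro conjI allI impI)
  fix m :: nat and w :: 'a
  assume card: "CARD('a) = 2 ^ m" and irr: "Factorial_Ring.irreducible [:1, - w, 1:]"
  have fin: "finite (UNIV :: 'a set)"
    using card by (simp add: card_ge_0_finite)
  note two = two_eq_zero_if_card_eq_two_power[OF card]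
  note sqrt = char2_finite_square_surj[OF fin two]
  have "num_classes SL2 (\<Union>(nonid_trace ` (- {w}))) = 2 ^ m - 1"
    using nonid_trace_in_conj_classes[OF two sqrt] card_nonid_trace_family[OF card]
    by (subst num_classes_Union[OF group_SL2]) auto
  then show "let A = vector [vector [1, 1], vector [0, 1]] :: 'a^2^2;
           B = vector [vector [0, 1], vector [- 1, w]] :: 'a^2^2
       in num_classes SL2 (conj_class SL2 A <#>\<^bsub>SL2\<^esub> conj_class SL2 B) = 2 ^ m - 1"
    using transvection2_companion2_product[OF two sqrt irreducible_quadratic_no_root[OF irr]]
    by (simp add: transvection2_def companion2_def)
next
  fix m :: nat
  assume card: "CARD('a) = 2 ^ m"
  have fin: "finite (UNIV :: 'a set)"
    using card by (simp add: card_ge_0_finite)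
  note two = two_eq_zero_if_card_eq_two_power[OF card]
  note sqrt = char2_finite_square_surj[OF fin two]
  obtain w :: 'a where no_root: "\<And>x. x\<^sup>2 - w * x + 1 \<noteq> 0"
    using exists_rootless_quadratic[OF fin] by blast
  have det1: "det (companion2 w) = 1"
    using companion2_mem[of w] by (simp add: nonid_trace_def)
  show "\<exists>A\<in>carrier (SL2 :: ('a^2^2) monoid). \<exists>B\<in>carrier (SL2 :: ('a^2^2) monoid).
         A \<notin> group_center SL2 \<and> B \<notin> group_center SL2 \<and>
         (\<exists>\<C>. \<C> \<subseteq> conj_classes SL2 \<and> card \<C> = 2 ^ m - 1 \<and>
              conj_class SL2 A <#>\<^bsub>SL2\<^esub> conj_class SL2 B = \<Union>\<C>)"
  proof (rule bexI[of _ transvection2], rule bexI[of _ "companion2 w"], intro conjI exI)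
    show "nonid_trace ` (- {w}) \<subseteq> conj_classes SL2"
      using nonid_trace_in_conj_classes[OF two sqrt] by blast
  qed (use det_transvection2 det1 transvection2_companion2_noncentral
      card_nonid_trace_family[OF card] transvection2_companion2_product[OF two sqrt no_root]
      in \<open>simp_all only: SL2_simps not_False_eq_True\<close>)
next
  show "CARD('n gf_two_pow) = 2 ^ CARD('n)"
    by (rule card_gf_two_pow)
qed

end
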